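(* Let $T$ be a monad on $\mathbf{Set}$ with Kleisli category $\mathbf{Kl}(T)$, free functor $\iota:\mathbf{Set}\to\mathbf{Kl}(T)$ and forgetful functor $|\cdot|:\mathbf{Kl}(T)\to\mathbf{Set}$, and assume $\mathbf{Kl}(T)$ has binary products. Let $\mathbf A^{op}$ be a reflective subcategory of $\mathbf{Kl}(T)$, with inclusion $j:\mathbf A^{op}\to\mathbf{Kl}(T)$ and reflector $r\dashv j$, and assume $\mathbf A^{op}$ has coequalisers. For $(X,R)\in\int\Psi$ let $p_1,p_2:R\to|X|$ be the projections, $p_i':\iota R\to X$ their transposes under $\iota\dashv|\cdot|$, and let $e:\bar{\mathcal S}(X,R)\to rX$ be the equaliser in $\mathbf A$ of $rp_1',rp_2':rX\to r\iota R$ (viewed as $\mathbf A$-morphisms). For a morphism $f:(X,R)\to(Y,S)$ of $\int\Psi$ let $\bar{\mathcal S}f$ be the unique $\mathbf A$-morphism $\bar{\mathcal S}(Y,S)\to\bar{\mathcal S}(X,R)$ with $e_{(X,R)}\circ\bar{\mathcal S}f=rf\circ e_{(Y,S)}$ in $\mathbf A$. Then $\bar{\mathcal S}$ is a functor $\int\Psi\to\mathbf A^{op}$ and it is left adjoint to $\mathrm{Eq}\circ j:\mathbf A^{op}\to\int\Psi$.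
   Context: In $\mathbf{Kl}(T)$ objects are sets, a morphism $X\to Y$ is a function $X\to TY$, $|X|=TX$, $|f|=\mu_Y\circ Tf$, and $\iota$ sends $g$ to $\eta\circ g$. Since $|\cdot|$ is a right adjoint it preserves products, so relations may be taken concretely: $\Psi X$ is the poset of subsets of $|X|\times|X|$, and $\int\Psi$ has objects $(X,R)$ with $R\subseteq|X|\times|X|$ and morphisms $f:(X,R)\to(Y,S)$ the Kleisli morphisms $f:X\to Y$ with $R\subseteq(|f|\times|f|)^{-1}(S)$. $\mathrm{Eq}:\mathbf{Kl}(T)\to\int\Psi$ sends $X\mapsto(X,=_{|X|})$ and $f\mapsto f$. A relation $R$ is regarded as a set with its two projections. For $f:(X,R)\to(Y,S)$ in $\int\Psi$, the equation $f\circ p_i'=q_i'\circ\iota g$ holds with $g:R\to S$ the restriction of $|f|\times|f|$, which makes the defining universal property of $\bar{\mathcal S}f$ applicable. *)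

theory Defs
  imports Main "HOL-Library.FuncSet" "HOL-Library.Nat_Bijection"
begin

section \<open>Categories, functors, adjunctions\<close>

record ('o, 'a) cat =
  Obj :: "'o set"
  Arr :: "'a set"
  Dom :: "'a \<Rightarrow> 'o"
  Cod :: "'a \<Rightarrow> 'o"
  Ident :: "'o \<Rightarrow> 'a"
  Comp :: "'a \<Rightarrow> 'a \<Rightarrow> 'a"  \<comment> \<open>\<open>Comp C g f\<close> is \<open>g\<close> after \<open>f\<close>\<close>

definition hom :: "('o, 'a) cat \<Rightarrow> 'o \<Rightarrow> 'o \<Rightarrow> 'a set" where
  "hom C X Y = {f \<in> Arr C. Dom C f = X \<and> Cod C f = Y}"

locale category =
  fixes C :: "('o, 'a) cat"
  assumes Dom_in_Obj: "f \<in> Arr C \<Longrightarrow> Dom C f \<in> Obj C"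
    and Cod_in_Obj: "f \<in> Arr C \<Longrightarrow> Cod C f \<in> Obj C"
    and Ident_in_hom: "X \<in> Obj C \<Longrightarrow> Ident C X \<in> hom C X X"
    and Comp_in_hom: "f \<in> hom C X Y \<Longrightarrow> g \<in> hom C Y Z \<Longrightarrow> Comp C g f \<in> hom C X Z"
    and Comp_Ident_left: "f \<in> hom C X Y \<Longrightarrow> Comp C (Ident C Y) f = f"
    and Comp_Ident_right: "f \<in> hom C X Y \<Longrightarrow> Comp C f (Ident C X) = f"
    and Comp_assoc: "f \<in> hom C W X \<Longrightarrow> g \<in> hom C X Y \<Longrightarrow> h \<in> hom C Y Z
      \<Longrightarrow> Comp C h (Comp C g f) = Comp C (Comp C h g) f"

definition op_cat :: "('o, 'a) cat \<Rightarrow> ('o, 'a) cat" where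
  "op_cat C = \<lparr>Obj = Obj C, Arr = Arr C, Dom = Cod C, Cod = Dom C, Ident = Ident C,
    Comp = (\<lambda>g f. Comp C f g)\<rparr>"

definition has_binary_products :: "('o, 'a) cat \<Rightarrow> bool" where
  "has_binary_products C \<longleftrightarrow> (\<forall>X \<in> Obj C. \<forall>Y \<in> Obj C. \<exists>P \<in> Obj C.
     \<exists>p \<in> hom C P X. \<exists>q \<in> hom C P Y.
       \<forall>Z \<in> Obj C. \<forall>f \<in> hom C Z X. \<forall>g \<in> hom C Z Y.
         \<exists>!h. h \<in> hom C Z P \<and> Comp C p h = f \<and> Comp C q h = g)"

definition is_equaliser :: "('o, 'a) cat \<Rightarrow> 'a \<Rightarrow> 'a \<Rightarrow> 'a \<Rightarrow> bool" where
  "is_equaliser C f g e \<longleftrightarrow>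
     e \<in> Arr C \<and> Cod C e = Dom C f \<and> Comp C f e = Comp C g e \<and>
     (\<forall>Z \<in> Obj C. \<forall>k \<in> hom C Z (Dom C f). Comp C f k = Comp C g k \<longrightarrow>
        (\<exists>!h. h \<in> hom C Z (Dom C e) \<and> Comp C e h = k))"

definition is_coequaliser :: "('o, 'a) cat \<Rightarrow> 'a \<Rightarrow> 'a \<Rightarrow> 'a \<Rightarrow> bool" where
  "is_coequaliser C f g c \<longleftrightarrow>
     c \<in> Arr C \<and> Dom C c = Cod C f \<and> Comp C c f = Comp C c g \<and>
     (\<forall>Z \<in> Obj C. \<forall>k \<in> hom C (Cod C f) Z. Comp C k f = Comp C k g \<longrightarrow>
        (\<exists>!h. h \<in> hom C (Cod C c) Z \<and> Comp C h c = k))"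

definition has_coequalisers :: "('o, 'a) cat \<Rightarrow> bool" where
  "has_coequalisers C \<longleftrightarrow> (\<forall>X \<in> Obj C. \<forall>Y \<in> Obj C. \<forall>f \<in> hom C X Y. \<forall>g \<in> hom C X Y.
     \<exists>c. is_coequaliser C f g c)"

record ('o, 'a, 'p, 'b) func =
  FO :: "'o \<Rightarrow> 'p"
  FA :: "'a \<Rightarrow> 'b"

definition is_functor :: "('o, 'a) cat \<Rightarrow> ('p, 'b) cat \<Rightarrow> ('o, 'a, 'p, 'b) func \<Rightarrow> bool" where
  "is_functor C D F \<longleftrightarrow> category C \<and> category D \<and>
     (\<forall>X \<in> Obj C. FO F X \<in> Obj D) \<and>
     (\<forall>X \<in> Obj C. \<forall>Y \<in> Obj C. \<forall>f \<in> hom C X Y. FA F f \<in> hom D (FO F X) (FO F Y)) \<and>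
     (\<forall>X \<in> Obj C. FA F (Ident C X) = Ident D (FO F X)) \<and>
     (\<forall>X \<in> Obj C. \<forall>Y \<in> Obj C. \<forall>Z \<in> Obj C. \<forall>f \<in> hom C X Y. \<forall>g \<in> hom C Y Z.
        FA F (Comp C g f) = Comp D (FA F g) (FA F f))"

definition id_func :: "('o, 'a, 'o, 'a) func" where
  "id_func = \<lparr>FO = (\<lambda>X. X), FA = (\<lambda>f. f)\<rparr>"

definition comp_func ::
    "('p, 'b, 'q, 'c) func \<Rightarrow> ('o, 'a, 'p, 'b) func \<Rightarrow> ('o, 'a, 'q, 'c) func" where
  "comp_func G F = \<lparr>FO = FO G \<circ> FO F, FA = FA G \<circ> FA F\<rparr>"

definition nat_trans :: "('o, 'a) cat \<Rightarrow> ('p, 'b) cat \<Rightarrow> ('o, 'a, 'p, 'b) func \<Rightarrow>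
    ('o, 'a, 'p, 'b) func \<Rightarrow> ('o \<Rightarrow> 'b) \<Rightarrow> bool" where
  "nat_trans C D F G \<alpha> \<longleftrightarrow> is_functor C D F \<and> is_functor C D G \<and>
     (\<forall>X \<in> Obj C. \<alpha> X \<in> hom D (FO F X) (FO G X)) \<and>
     (\<forall>X \<in> Obj C. \<forall>Y \<in> Obj C. \<forall>f \<in> hom C X Y.
        Comp D (\<alpha> Y) (FA F f) = Comp D (FA G f) (\<alpha> X))"

definition adjunction :: "('o, 'a) cat \<Rightarrow> ('p, 'b) cat \<Rightarrow> ('o, 'a, 'p, 'b) func \<Rightarrow>
    ('p, 'b, 'o, 'a) func \<Rightarrow> ('o \<Rightarrow> 'p \<Rightarrow> 'b \<Rightarrow> 'a) \<Rightarrow> bool" where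
  "adjunction C D F G \<phi> \<longleftrightarrow> is_functor C D F \<and> is_functor D C G \<and>
     (\<forall>X \<in> Obj C. \<forall>A \<in> Obj D. bij_betw (\<phi> X A) (hom D (FO F X) A) (hom C X (FO G A))) \<and>
     (\<forall>X \<in> Obj C. \<forall>X' \<in> Obj C. \<forall>A \<in> Obj D. \<forall>B \<in> Obj D.
        \<forall>k \<in> hom C X' X. \<forall>h \<in> hom D (FO F X) A. \<forall>g \<in> hom D A B.
          \<phi> X' B (Comp D g (Comp D h (FA F k))) = Comp C (FA G g) (Comp C (\<phi> X A h) k))"

definition left_adjoint :: "('o, 'a) cat \<Rightarrow> ('p, 'b) cat \<Rightarrow> ('o, 'a, 'p, 'b) func \<Rightarrow>
    ('p, 'b, 'o, 'a) func \<Rightarrow> bool" where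
  "left_adjoint C D F G \<longleftrightarrow> (\<exists>\<phi>. adjunction C D F G \<phi>)"

text \<open>Up to isomorphism of categories, the functors below are exactly the inclusions of
  (not necessarily full) subcategories. Fullness is not part of the notion of a reflective
  subcategory used here; full reflective subcategories are a special case.\<close>

definition subcategory_inclusion ::
    "('p, 'b) cat \<Rightarrow> ('o, 'a) cat \<Rightarrow> ('p, 'b, 'o, 'a) func \<Rightarrow> bool" where
  "subcategory_inclusion B C j \<longleftrightarrow> is_functor B C j \<and> inj_on (FO j) (Obj B) \<and>
     (\<forall>X \<in> Obj B. \<forall>Y \<in> Obj B. inj_on (FA j) (hom B X Y))"

definition reflective_subcategory :: "('p, 'b) cat \<Rightarrow> ('o, 'a) cat \<Rightarrow>
    ('p, 'b, 'o, 'a) func \<Rightarrow> ('o, 'a, 'p, 'b) func \<Rightarrow> bool" where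
  "reflective_subcategory B C j r \<longleftrightarrow> subcategory_inclusion B C j \<and> left_adjoint C B r j"


section \<open>Monads and Kleisli categories\<close>

record ('o, 'a) monad_data =
  endo :: "('o, 'a, 'o, 'a) func"
  unit :: "'o \<Rightarrow> 'a"
  mult :: "'o \<Rightarrow> 'a"

definition is_monad :: "('o, 'a) cat \<Rightarrow> ('o, 'a) monad_data \<Rightarrow> bool" where
  "is_monad C T \<longleftrightarrow>
     nat_trans C C id_func (endo T) (unit T) \<and>
     nat_trans C C (comp_func (endo T) (endo T)) (endo T) (mult T) \<and>
     (\<forall>X \<in> Obj C.
        Comp C (mult T X) (FA (endo T) (mult T X)) =
          Comp C (mult T X) (mult T (FO (endo T) X)) \<and>
        Comp C (mult T X) (FA (endo T) (unit T X)) = Ident C (FO (endo T) X) \<and>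
        Comp C (mult T X) (unit T (FO (endo T) X)) = Ident C (FO (endo T) X))"

text \<open>A Kleisli morphism \<open>X \<rightarrow> Y\<close>
  is a pair \<open>(f, Y)\<close>: its codomain \<open>Y\<close> cannot be recovered from \<open>f : X \<rightarrow> T Y\<close> alone.\<close>

definition forget :: "('o, 'a) cat \<Rightarrow> ('o, 'a) monad_data \<Rightarrow> ('o, 'a \<times> 'o, 'o, 'a) func" where
  "forget C T = \<lparr>FO = FO (endo T),
    FA = (\<lambda>(f, Y). Comp C (mult T Y) (FA (endo T) f))\<rparr>"

definition kleisli :: "('o, 'a) cat \<Rightarrow> ('o, 'a) monad_data \<Rightarrow> ('o, 'a \<times> 'o) cat" where
  "kleisli C T = \<lparr>Obj = Obj C,
    Arr = {(f, Y). Y \<in> Obj C \<and> f \<in> Arr C \<and> Cod C f = FO (endo T) Y},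
    Dom = (\<lambda>(f, Y). Dom C f),
    Cod = (\<lambda>(f, Y). Y),
    Ident = (\<lambda>X. (unit T X, X)),
    Comp = (\<lambda>(g, Z) (f, Y). (Comp C (Comp C (mult T Z) (FA (endo T) g)) f, Z))\<rparr>"

definition iota :: "('o, 'a) cat \<Rightarrow> ('o, 'a) monad_data \<Rightarrow> ('o, 'a, 'o, 'a \<times> 'o) func" where
  "iota C T = \<lparr>FO = (\<lambda>X. X), FA = (\<lambda>g. (Comp C (unit T (Cod C g)) g, Cod C g))\<rparr>"

text \<open>The transpose \<open>\<iota> A \<rightarrow> X\<close> of \<open>g : A \<rightarrow> |X| = T X\<close>; see \<open>iota_forget_adjunction\<close> and lemma
  \<open>kl_transpose\<close> below.\<close>

definition kl_transpose :: "'o \<Rightarrow> 'a \<Rightarrow> 'a \<times> 'o" where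
  "kl_transpose X g = (g, X)"

context
  fixes C :: "('o, 'a) cat" and T :: "('o, 'a) monad_data"
  assumes monad: "is_monad C T"
begin

private abbreviation "T0 \<equiv> FO (endo T)"
private abbreviation "T1 \<equiv> FA (endo T)"

private lemma C: "category C"
  using monad by (simp add: is_monad_def nat_trans_def is_functor_def)

private lemma T0: "X \<in> Obj C \<Longrightarrow> T0 X \<in> Obj C"
  using monad by (simp add: is_monad_def nat_trans_def is_functor_def)

private lemma obj: "f \<in> hom C X Y \<Longrightarrow> X \<in> Obj C \<and> Y \<in> Obj C"
  using category.Dom_in_Obj[OF C] category.Cod_in_Obj[OF C] by (auto simp: hom_def)

private lemma T1: "f \<in> hom C X Y \<Longrightarrow> T1 f \<in> hom C (T0 X) (T0 Y)"
  using monad obj by (simp add: is_monad_def nat_trans_def is_functor_def)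

private lemma T1_Ident: "X \<in> Obj C \<Longrightarrow> T1 (Ident C X) = Ident C (T0 X)"
  using monad by (simp add: is_monad_def nat_trans_def is_functor_def)

private lemma T1_Comp:
  assumes "f \<in> hom C X Y" "g \<in> hom C Y Z"
  shows "T1 (Comp C g f) = Comp C (T1 g) (T1 f)"
  using monad assms obj[OF assms(1)] obj[OF assms(2)]
  unfolding is_monad_def nat_trans_def is_functor_def by meson

private lemma unit: "X \<in> Obj C \<Longrightarrow> unit T X \<in> hom C X (T0 X)"
  using monad by (simp add: is_monad_def nat_trans_def id_func_def)

private lemma mult: "X \<in> Obj C \<Longrightarrow> mult T X \<in> hom C (T0 (T0 X)) (T0 X)"
  using monad by (simp add: is_monad_def nat_trans_def comp_func_def)

private lemma unit_nat:
  "f \<in> hom C X Y \<Longrightarrow> Comp C (unit T Y) f = Comp C (T1 f) (unit T X)"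
  using monad obj by (simp add: is_monad_def nat_trans_def id_func_def)

private lemma mult_nat:
  "f \<in> hom C X Y \<Longrightarrow> Comp C (mult T Y) (T1 (T1 f)) = Comp C (T1 f) (mult T X)"
  using monad obj by (simp add: is_monad_def nat_trans_def comp_func_def)

private lemma laws:
  assumes "X \<in> Obj C"
  shows "Comp C (mult T X) (T1 (mult T X)) = Comp C (mult T X) (mult T (T0 X))"
    and "Comp C (mult T X) (T1 (unit T X)) = Ident C (T0 X)"
    and "Comp C (mult T X) (unit T (T0 X)) = Ident C (T0 X)"
  using monad assms by (simp_all add: is_monad_def)

private lemmas comp = category.Comp_in_hom[OF C]
private lemmas assoc = category.Comp_assoc[OF C]
private lemmas idl = category.Comp_Ident_left[OF C]
private lemmas idr = category.Comp_Ident_right[OF C]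

private definition "ext Y f = Comp C (mult T Y) (T1 f)"

private lemma ext: "f \<in> hom C X (T0 Y) \<Longrightarrow> Y \<in> Obj C \<Longrightarrow> ext Y f \<in> hom C (T0 X) (T0 Y)"
  unfolding ext_def by (blast intro: comp T1 mult)

private lemma ext_unit:
  assumes f: "f \<in> hom C X (T0 Y)" and Y: "Y \<in> Obj C"
  shows "Comp C (ext Y f) (unit T X) = f"
proof -
  have X: "X \<in> Obj C" using obj f by blast
  have "Comp C (ext Y f) (unit T X) = Comp C (mult T Y) (Comp C (T1 f) (unit T X))"
    unfolding ext_def using assoc[OF unit[OF X] T1[OF f] mult[OF Y]] by simp
  also have "\<dots> = Comp C (mult T Y) (Comp C (unit T (T0 Y)) f)"
    using unit_nat[OF f] by simp
  also have "\<dots> = f"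
    using assoc[OF f unit[OF T0[OF Y]] mult[OF Y]] laws(3)[OF Y] idl[OF f] by simp
  finally show ?thesis .
qed

private lemma ext_ext:
  assumes f: "f \<in> hom C X (T0 Y)" and g: "g \<in> hom C Y (T0 Z)" and Z: "Z \<in> Obj C"
  shows "ext Z (Comp C (ext Z g) f) = Comp C (ext Z g) (ext Y f)"
proof -
  have Y: "Y \<in> Obj C" using obj g by blast
  note h = mult[OF Z] mult[OF Y] mult[OF T0[OF Z]] T1[OF f] T1[OF g] T1[OF T1[OF g]]
    T1[OF mult[OF Z]]
  have "ext Z (Comp C (ext Z g) f) = Comp C (mult T Z) (Comp C (T1 (ext Z g)) (T1 f))"
    unfolding ext_def[of Z "Comp C _ _"] using T1_Comp[OF f ext[OF g Z]] by simp
  also have "T1 (ext Z g) = Comp C (T1 (mult T Z)) (T1 (T1 g))"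
    unfolding ext_def using T1_Comp[OF T1[OF g] mult[OF Z]] by simp
  also have "Comp C (mult T Z) (Comp C (Comp C (T1 (mult T Z)) (T1 (T1 g))) (T1 f)) =
      Comp C (Comp C (mult T Z) (Comp C (T1 (mult T Z)) (T1 (T1 g)))) (T1 f)"
    using assoc[OF h(4) comp[OF h(6) h(7)] h(1)] .
  also have "Comp C (mult T Z) (Comp C (T1 (mult T Z)) (T1 (T1 g))) =
      Comp C (Comp C (mult T Z) (T1 (mult T Z))) (T1 (T1 g))"
    using assoc[OF h(6) h(7) h(1)] .
  also have "\<dots> = Comp C (mult T Z) (Comp C (mult T (T0 Z)) (T1 (T1 g)))"
    using laws(1)[OF Z] assoc[OF h(6) h(3) h(1)] by simp
  also have "\<dots> = Comp C (mult T Z) (Comp C (T1 g) (mult T Y))"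
    using mult_nat[OF g] by simp
  also have "\<dots> = Comp C (ext Z g) (mult T Y)"
    unfolding ext_def using assoc[OF h(2) h(5) h(1)] .
  also have "Comp C \<dots> (T1 f) = Comp C (ext Z g) (ext Y f)"
    unfolding ext_def[of Y] using assoc[OF h(4) h(2) ext[OF g Z]] by simp
  finally show ?thesis .
qed

private lemma kl_hom:
  "h \<in> hom (kleisli C T) X Y \<longleftrightarrow> (\<exists>f \<in> hom C X (T0 Y). h = (f, Y)) \<and> Y \<in> Obj C"
  by (cases h) (auto simp: kleisli_def hom_def)

private lemma kl_simps:
  "Obj (kleisli C T) = Obj C"
  "Ident (kleisli C T) X = (unit T X, X)"
  "Comp (kleisli C T) (g, Z) (f, Y) = (Comp C (ext Z g) f, Z)"
  "FO (forget C T) X = T0 X"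
  "FA (forget C T) (f, Y) = ext Y f"
  by (simp_all add: kleisli_def forget_def ext_def)

private lemma ext_unit_id: "X \<in> Obj C \<Longrightarrow> ext X (unit T X) = Ident C (T0 X)"
  using laws(2) by (simp add: ext_def)

lemma category_kleisli: "category (kleisli C T)"
proof unfold_locales
  fix f assume "f \<in> Arr (kleisli C T)"
  then show "Dom (kleisli C T) f \<in> Obj (kleisli C T)" "Cod (kleisli C T) f \<in> Obj (kleisli C T)"
    using category.Dom_in_Obj[OF C] by (auto simp: kleisli_def)
next
  fix f g h W X Y Z
  assume "f \<in> hom (kleisli C T) W X" "g \<in> hom (kleisli C T) X Y" "h \<in> hom (kleisli C T) Y Z"
  then obtain f' g' h' where f: "f = (f', X)" "f' \<in> hom C W (T0 X)"
    and g: "g = (g', Y)" "g' \<in> hom C X (T0 Y)" and h: "h = (h', Z)" "h' \<in> hom C Y (T0 Z)"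
    and obs: "X \<in> Obj C" "Y \<in> Obj C" "Z \<in> Obj C"
    by (auto simp: kl_hom)
  show "Comp (kleisli C T) h (Comp (kleisli C T) g f) = Comp (kleisli C T) (Comp (kleisli C T) h g) f"
    using assoc[OF f(2) ext[OF g(2) obs(2)] ext[OF h(2) obs(3)]] ext_ext[OF g(2) h(2) obs(3)]
    by (simp add: f g h kl_simps)
qed (auto simp: kl_hom kl_simps ext_unit ext_unit_id idl intro: unit comp[OF _ ext])

lemma is_functor_forget: "is_functor (kleisli C T) C (forget C T)"
  unfolding is_functor_def
  by (auto simp: category_kleisli C kl_hom kl_simps T0 ext ext_unit_id ext_ext)

private lemma ext_iota:
  assumes f: "f \<in> hom C X Y"
  shows "ext Y (Comp C (unit T Y) f) = T1 f"
proof -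
  have Y: "Y \<in> Obj C" using obj f by blast
  show ?thesis
    unfolding ext_def using T1_Comp[OF f unit[OF Y]] laws(2)[OF Y] idl[OF T1[OF f]]
      assoc[OF T1[OF f] T1[OF unit[OF Y]] mult[OF Y]] by simp
qed

private lemma iota_simps:
  "FO (iota C T) X = X"
  "f \<in> hom C X Y \<Longrightarrow> FA (iota C T) f = (Comp C (unit T Y) f, Y)"
  by (auto simp: iota_def hom_def)

lemma is_functor_iota: "is_functor C (kleisli C T) (iota C T)"
  unfolding is_functor_def
proof (intro conjI ballI)
  fix X Y Z f g
  assume f: "f \<in> hom C X Y" and g: "g \<in> hom C Y Z"
  have Y: "Y \<in> Obj C" and Z: "Z \<in> Obj C" using obj g by auto
  show "FA (iota C T) (Comp C g f) = Comp (kleisli C T) (FA (iota C T) g) (FA (iota C T) f)"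
    using f g comp[OF f g] assoc[OF f g unit[OF Z]] ext_iota[OF g] unit_nat[OF g]
      assoc[OF f unit[OF Y] T1[OF g]]
    by (simp add: iota_simps kl_simps)
next
  fix X assume X: "X \<in> Obj C"
  show "FA (iota C T) (Ident C X) = Ident (kleisli C T) (FO (iota C T) X)"
    using category.Ident_in_hom[OF C X] idr[OF unit[OF X]] by (simp add: iota_simps kl_simps)
qed (auto simp: category_kleisli C kl_simps iota_simps kl_hom intro: comp unit)

lemma iota_forget_adjunction:
  "adjunction C (kleisli C T) (iota C T) (forget C T)
     (\<lambda>A X h. Comp C (FA (forget C T) h) (unit T A))"
  unfolding adjunction_def
proof (intro conjI ballI)
  fix A X assume A: "A \<in> Obj C" and X: "X \<in> Obj (kleisli C T)"
  show "bij_betw (\<lambda>h. Comp C (FA (forget C T) h) (unit T A))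
      (hom (kleisli C T) (FO (iota C T) A) X) (hom C A (FO (forget C T) X))"
    by (rule bij_betw_byWitness[where f' = "\<lambda>g. (g, X)"])
      (use X in \<open>auto simp: kl_hom kl_simps iota_simps ext_unit\<close>)
next
  fix A A' X Y k h g
  assume k: "k \<in> hom C A' A" and h: "h \<in> hom (kleisli C T) (FO (iota C T) A) X"
    and g: "g \<in> hom (kleisli C T) X Y"
  obtain h' g' where h': "h = (h', X)" "h' \<in> hom C A (T0 X)"
    and g': "g = (g', Y)" "g' \<in> hom C X (T0 Y)" and X: "X \<in> Obj C" and Y: "Y \<in> Obj C"
    using h g by (auto simp: kl_hom iota_simps)
  have A: "A \<in> Obj C" using obj k by blast
  have "Comp C (ext X h') (Comp C (unit T A) k) = Comp C h' k"
    using assoc[OF k unit[OF A] ext[OF h'(2) X]] ext_unit[OF h'(2) X] by simp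
  then show "Comp C (FA (forget C T)
        (Comp (kleisli C T) g (Comp (kleisli C T) h (FA (iota C T) k)))) (unit T A') =
      Comp C (FA (forget C T) g) (Comp C (Comp C (FA (forget C T) h) (unit T A)) k)"
    using ext_unit[OF comp[OF comp[OF k h'(2)] ext[OF g'(2) Y]] Y] ext_unit[OF h'(2) X]
    by (simp add: h' g' kl_simps iota_simps(2)[OF k])
qed (rule is_functor_iota is_functor_forget)+

lemma kl_transpose:
  assumes "X \<in> Obj C" and "g \<in> hom C A (FO (forget C T) X)"
  shows "kl_transpose X g \<in> hom (kleisli C T) (FO (iota C T) A) X"
    and "Comp C (FA (forget C T) (kl_transpose X g)) (unit T A) = g"
  using assms by (auto simp: kl_transpose_def kl_hom kl_simps iota_simps ext_unit)

end


section \<open>The category of sets\<close>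

text \<open>HOL has no type of all sets. The category of sets is therefore taken relative to a type \<open>'u\<close>
  of potential elements, a collection \<open>U\<close> of small subsets of \<open>'u\<close> and a pairing operation. Only
  closure under subsets and binary products is required, which is what makes a relation between
  small sets a small set again. A model of ZFC, with \<open>U\<close> the collection of the extensions
  of its sets, is a special case, as is any Grothendieck universe.\<close>

locale set_universe =
  fixes U :: "'u set set" and pr :: "'u \<times> 'u \<Rightarrow> 'u"
  assumes inj_pr: "inj pr"
    and subset_closed: "A \<in> U \<Longrightarrow> B \<subseteq> A \<Longrightarrow> B \<in> U"
    and prod_closed: "A \<in> U \<Longrightarrow> B \<in> U \<Longrightarrow> pr ` (A \<times> B) \<in> U"

lemma set_universe_nat: "set_universe (UNIV :: nat set set) prod_encode"
  by unfold_locales (auto simp: inj_prod_encode)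

type_synonym 'u set_arr = "'u set \<times> ('u \<Rightarrow> 'u) \<times> 'u set"

definition app :: "'u set_arr \<Rightarrow> 'u \<Rightarrow> 'u" where
  "app f = fst (snd f)"

definition set_cat :: "'u set set \<Rightarrow> ('u set, 'u set_arr) cat" where
  "set_cat U = \<lparr>Obj = U,
    Arr = {(A, f, B). A \<in> U \<and> B \<in> U \<and> f \<in> A \<rightarrow>\<^sub>E B},
    Dom = (\<lambda>(A, f, B). A),
    Cod = (\<lambda>(A, f, B). B),
    Ident = (\<lambda>A. (A, \<lambda>x \<in> A. x, A)),
    Comp = (\<lambda>(B', g, C) (A, f, B). (A, compose A g f, C))\<rparr>"

lemma category_set_cat: "category (set_cat U)"
proof unfold_locales
  fix f X Y
  assume "f \<in> hom (set_cat U) X Y"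
  then obtain f' where f: "f = (X, f', Y)" "f' \<in> X \<rightarrow>\<^sub>E Y"
    by (auto simp: set_cat_def hom_def)
  have "compose X (\<lambda>x \<in> Y. x) f' = f'" "compose X f' (\<lambda>x \<in> X. x) = f'"
    using f(2) by (auto simp: compose_def PiE_iff extensional_def fun_eq_iff)
  then show "Comp (set_cat U) (Ident (set_cat U) Y) f = f"
    and "Comp (set_cat U) f (Ident (set_cat U) X) = f"
    by (simp_all add: f(1) set_cat_def)
qed (auto simp: set_cat_def hom_def compose_def PiE_iff extensional_def fun_eq_iff)

text \<open>A relation regarded as a small set, with its two projections to \<open>A\<close>.\<close>

definition rel_set :: "('u \<times> 'u \<Rightarrow> 'u) \<Rightarrow> 'u rel \<Rightarrow> 'u set" where
  "rel_set pr R = pr ` R"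

definition rel_proj1 :: "('u \<times> 'u \<Rightarrow> 'u) \<Rightarrow> 'u set \<Rightarrow> 'u rel \<Rightarrow> 'u set_arr" where
  "rel_proj1 pr A R = (rel_set pr R, \<lambda>z \<in> rel_set pr R. fst (inv pr z), A)"

definition rel_proj2 :: "('u \<times> 'u \<Rightarrow> 'u) \<Rightarrow> 'u set \<Rightarrow> 'u rel \<Rightarrow> 'u set_arr" where
  "rel_proj2 pr A R = (rel_set pr R, \<lambda>z \<in> rel_set pr R. snd (inv pr z), A)"


section \<open>Relations over a Kleisli category, and the functors between them\<close>

type_synonym 'u set_monad = "('u set, 'u set_arr) monad_data"
type_synonym 'u kl_arr = "'u set_arr \<times> 'u set"
type_synonym 'u rel_obj = "'u set \<times> 'u rel"
type_synonym 'u rel_arr = "'u rel_obj \<times> 'u kl_arr \<times> 'u rel_obj"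

abbreviation Kl :: "'u set set \<Rightarrow> 'u set_monad \<Rightarrow> ('u set, 'u kl_arr) cat" where
  "Kl U T \<equiv> kleisli (set_cat U) T"

definition under_fun :: "'u set set \<Rightarrow> 'u set_monad \<Rightarrow> 'u kl_arr \<Rightarrow> 'u \<Rightarrow> 'u" where
  "under_fun U T f = app (FA (forget (set_cat U) T) f)"

definition int_Psi :: "'u set set \<Rightarrow> 'u set_monad \<Rightarrow> ('u rel_obj, 'u rel_arr) cat" where
  "int_Psi U T =
    (let Ob = {(X, R). X \<in> U \<and> R \<subseteq> FO (forget (set_cat U) T) X \<times> FO (forget (set_cat U) T) X}
     in \<lparr>Obj = Ob,
       Arr = {((X, R), f, (Y, S)). (X, R) \<in> Ob \<and> (Y, S) \<in> Ob \<and> f \<in> hom (Kl U T) X Y \<and>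
                R \<subseteq> map_prod (under_fun U T f) (under_fun U T f) -` S},
       Dom = (\<lambda>(XR, f, YS). XR),
       Cod = (\<lambda>(XR, f, YS). YS),
       Ident = (\<lambda>(X, R). ((X, R), Ident (Kl U T) X, (X, R))),
       Comp = (\<lambda>(YS', g, ZQ) (XR, f, YS). (XR, Comp (Kl U T) g f, ZQ))\<rparr>)"

definition Eq_func ::
    "'u set set \<Rightarrow> 'u set_monad \<Rightarrow> ('u set, 'u kl_arr, 'u rel_obj, 'u rel_arr) func" where
  "Eq_func U T =
    (let Eq = (\<lambda>X. (X, Id_on (FO (forget (set_cat U) T) X)))
     in \<lparr>FO = Eq, FA = (\<lambda>f. (Eq (Dom (Kl U T) f), f, Eq (Cod (Kl U T) f)))\<rparr>)"

definition proj1' ::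
    "('u \<times> 'u \<Rightarrow> 'u) \<Rightarrow> 'u set set \<Rightarrow> 'u set_monad \<Rightarrow> 'u rel_obj \<Rightarrow> 'u kl_arr" where
  "proj1' pr U T = (\<lambda>(X, R). kl_transpose X (rel_proj1 pr (FO (forget (set_cat U) T) X) R))"

definition proj2' ::
    "('u \<times> 'u \<Rightarrow> 'u) \<Rightarrow> 'u set set \<Rightarrow> 'u set_monad \<Rightarrow> 'u rel_obj \<Rightarrow> 'u kl_arr" where
  "proj2' pr U T = (\<lambda>(X, R). kl_transpose X (rel_proj2 pr (FO (forget (set_cat U) T) X) R))"

text \<open>\<open>e\<close> is a choice of equalisers; the reflector \<open>r\<close> goes from the Kleisli category to the opposite
  of \<open>A\<close>, so that \<open>r f : r Y \<rightarrow> r X\<close> in \<open>A\<close> for \<open>f : X \<rightarrow> Y\<close>.\<close>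

definition is_Sbar_map :: "('p, 'b) cat \<Rightarrow> ('u set, 'u kl_arr, 'p, 'b) func \<Rightarrow>
    ('u rel_obj \<Rightarrow> 'b) \<Rightarrow> 'u rel_arr \<Rightarrow> 'b \<Rightarrow> bool" where
  "is_Sbar_map A r e = (\<lambda>(XR, f, YS) h.
     h \<in> hom A (Dom A (e YS)) (Dom A (e XR)) \<and>
     Comp A (e XR) h = Comp A (FA r f) (e YS))"

definition Sbar :: "('p, 'b) cat \<Rightarrow> ('u set, 'u kl_arr, 'p, 'b) func \<Rightarrow>
    ('u rel_obj \<Rightarrow> 'b) \<Rightarrow> ('u rel_obj, 'u rel_arr, 'p, 'b) func" where
  "Sbar A r e = \<lparr>FO = (\<lambda>XR. Dom A (e XR)), FA = (\<lambda>F. THE h. is_Sbar_map A r e F h)\<rparr>"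

end

theory Submission
  imports Defs
begin

text \<open>
  A Kleisli morphism \<open>k : X \<rightarrow> Y\<close> underlies a morphism \<open>(X, R) \<rightarrow> Eq Y\<close> iff \<open>k \<circ> p\<^sub>1' = k \<circ> p\<^sub>2'\<close>. For
  \<open>Y = j Z\<close> this says, after transposing along \<open>r \<stileturn> j\<close>, that \<open>r X \<rightarrow> Z\<close> coequalises \<open>r p\<^sub>1'\<close> and
  \<open>r p\<^sub>2'\<close> in \<open>A\<^sup>o\<^sup>p\<close>, i.e. factors uniquely through \<open>e\<close>. Hence the transpose of \<open>e\<close> is a universal arrow
  from \<open>(X, R)\<close> to \<open>Eq \<circ> j\<close>, and the equation defining \<open>Sbar f\<close> is the transpose of the equation which
  defines the action on arrows of the left adjoint determined by these universal arrows.
\<close>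

section \<open>Functors, adjunctions and universal arrows\<close>

lemma hom_Obj:
  assumes "category C" "f \<in> hom C X Y"
  shows "X \<in> Obj C" "Y \<in> Obj C"
  using assms category.Dom_in_Obj category.Cod_in_Obj by (fastforce simp: hom_def)+

text \<open>The object conditions in \<open>is_functor\<close> are discharged by
  \<open>hom_Obj\<close>, so later uses need only supply arrows.\<close>

lemma is_functorD:
  assumes "is_functor C D F"
  shows "category C" "category D"
    and "X \<in> Obj C \<Longrightarrow> FO F X \<in> Obj D"
    and "f \<in> hom C X Y \<Longrightarrow> FA F f \<in> hom D (FO F X) (FO F Y)"
    and "X \<in> Obj C \<Longrightarrow> FA F (Ident C X) = Ident D (FO F X)"
    and "f \<in> hom C X Y \<Longrightarrow> g \<in> hom C Y Z \<Longrightarrow> FA F (Comp C g f) = Comp D (FA F g) (FA F f)"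
proof -
  show C: "category C" and "category D"
    using assms by (simp_all add: is_functor_def)
  show "X \<in> Obj C \<Longrightarrow> FO F X \<in> Obj D"
    and "X \<in> Obj C \<Longrightarrow> FA F (Ident C X) = Ident D (FO F X)"
    using assms by (simp_all add: is_functor_def)
  show "FA F f \<in> hom D (FO F X) (FO F Y)" if "f \<in> hom C X Y"
    using assms that hom_Obj[OF C that] by (simp add: is_functor_def)
  show "FA F (Comp C g f) = Comp D (FA F g) (FA F f)"
    if "f \<in> hom C X Y" "g \<in> hom C Y Z"
    using assms that hom_Obj[OF C that(1)] hom_Obj[OF C that(2)] unfolding is_functor_def by meson
qed

lemma is_functor_comp_func:
  assumes F: "is_functor C D F" and G: "is_functor D E G"
  shows "is_functor C E (comp_func G F)"
  unfolding is_functor_def comp_func_def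
  using is_functorD(1-5)[OF F] is_functorD(2-5)[OF G]
  by (auto simp: is_functorD(6)[OF F] is_functorD(6)[OF G is_functorD(4)[OF F] is_functorD(4)[OF F]])

text \<open>\<open>adjunction\<close> states naturality jointly in both variables; the last two
  clauses come from putting an identity in for \<open>g\<close> or for \<open>k\<close>.\<close>

lemma adjunctionD:
  assumes "adjunction C D F G \<phi>"
  shows "is_functor C D F" "is_functor D C G"
    and "X \<in> Obj C \<Longrightarrow> Z \<in> Obj D \<Longrightarrow> bij_betw (\<phi> X Z) (hom D (FO F X) Z) (hom C X (FO G Z))"
    and "k \<in> hom C X' X \<Longrightarrow> Z \<in> Obj D \<Longrightarrow> h \<in> hom D (FO F X) Z \<Longrightarrow>
      \<phi> X' Z (Comp D h (FA F k)) = Comp C (\<phi> X Z h) k"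
    and "X \<in> Obj C \<Longrightarrow> h \<in> hom D (FO F X) Z \<Longrightarrow> g \<in> hom D Z W \<Longrightarrow>
      \<phi> X W (Comp D g h) = Comp C (FA G g) (\<phi> X Z h)"
proof -
  show F: "is_functor C D F" and G: "is_functor D C G"
    using assms by (simp_all add: adjunction_def)
  show bij: "bij_betw (\<phi> X Z) (hom D (FO F X) Z) (hom C X (FO G Z))"
    if "X \<in> Obj C" "Z \<in> Obj D" for X Z
    using assms that by (simp add: adjunction_def)
  note C = is_functorD(1)[OF F] and D = is_functorD(2)[OF F]
  have nat: "\<phi> X' W (Comp D g (Comp D h (FA F k))) = Comp C (FA G g) (Comp C (\<phi> X Z h) k)"
    if "k \<in> hom C X' X" "h \<in> hom D (FO F X) Z" "g \<in> hom D Z W" for X' X Z W k h g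
    using assms that hom_Obj[OF C that(1)] hom_Obj[OF D that(3)] unfolding adjunction_def by meson
  show "\<phi> X' Z (Comp D h (FA F k)) = Comp C (\<phi> X Z h) k"
    if k: "k \<in> hom C X' X" and Z: "Z \<in> Obj D" and h: "h \<in> hom D (FO F X) Z"
  proof -
    have hk: "Comp D h (FA F k) \<in> hom D (FO F X') Z"
      using category.Comp_in_hom[OF D is_functorD(4)[OF F k] h] .
    \<comment> \<open>The identity left over from \<open>FA G\<close> cancels only once the
      transpose is known to lie in a hom set, hence the appeal to \<open>bij\<close>.\<close>
    have "\<phi> X Z h \<in> hom C X (FO G Z)"
      using bij[OF hom_Obj(2)[OF C k] Z] h by (auto simp: bij_betw_def)
    then have "Comp C (\<phi> X Z h) k \<in> hom C X' (FO G Z)"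
      using category.Comp_in_hom[OF C k] by blast
    then show ?thesis
      using nat[OF k h category.Ident_in_hom[OF D Z]] category.Comp_Ident_left[OF D hk]
        is_functorD(5)[OF G Z] category.Comp_Ident_left[OF C] by simp
  qed
  show "\<phi> X W (Comp D g h) = Comp C (FA G g) (\<phi> X Z h)"
    if X: "X \<in> Obj C" and h: "h \<in> hom D (FO F X) Z" and g: "g \<in> hom D Z W"
  proof -
    have "\<phi> X Z h \<in> hom C X (FO G Z)"
      using bij[OF X hom_Obj(2)[OF D h]] h by (auto simp: bij_betw_def)
    then show ?thesis
      using nat[OF category.Ident_in_hom[OF C X] h g] is_functorD(5)[OF F X]
        category.Comp_Ident_right[OF D h] category.Comp_Ident_right[OF C] by simp
  qed
qed

text \<open>Arrows out of \<open>FO F X\<close> are determined by their composite with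
  \<open>\<eta> X\<close>, so the functor laws for \<open>F\<close> can be checked after composing,
  and \<open>univ\<close> itself is the hom bijection. The action on arrows is given in advance and
  constrained by \<open>nat\<close>, which suits \<open>Sbar\<close>, whose action is fixed by an
  equation of its own.\<close>

lemma universal_arrows_adjunction:
  assumes C: "category C" and G: "is_functor D C G"
    and FO: "\<And>X. X \<in> Obj C \<Longrightarrow> FO F X \<in> Obj D"
    and unit: "\<And>X. X \<in> Obj C \<Longrightarrow> \<eta> X \<in> hom C X (FO G (FO F X))"
    and univ: "\<And>X Z k. X \<in> Obj C \<Longrightarrow> Z \<in> Obj D \<Longrightarrow> k \<in> hom C X (FO G Z) \<Longrightarrow>
      \<exists>!h. h \<in> hom D (FO F X) Z \<and> Comp C (FA G h) (\<eta> X) = k"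
    and FA: "\<And>X Y f. f \<in> hom C X Y \<Longrightarrow> FA F f \<in> hom D (FO F X) (FO F Y)"
    and nat: "\<And>X Y f. f \<in> hom C X Y \<Longrightarrow> Comp C (FA G (FA F f)) (\<eta> X) = Comp C (\<eta> Y) f"
  shows "adjunction C D F G (\<lambda>X Z h. Comp C (FA G h) (\<eta> X))"
proof -
  note D = is_functorD(1)[OF G]
  have eqI: "h = h'" if "X \<in> Obj C" "h \<in> hom D (FO F X) Z" "h' \<in> hom D (FO F X) Z"
    "Comp C (FA G h) (\<eta> X) = Comp C (FA G h') (\<eta> X)" for X Z h h'
  proof -
    have Z: "Z \<in> Obj D" using hom_Obj[OF D that(2)] by simp
    have "Comp C (FA G h) (\<eta> X) \<in> hom C X (FO G Z)"
      using category.Comp_in_hom[OF C unit[OF that(1)] is_functorD(4)[OF G that(2)]] .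
    then show ?thesis using univ[OF that(1) Z] that by metis
  qed
  have comp: "Comp C (FA G (Comp D g h)) (\<eta> X) = Comp C (FA G g) (Comp C (FA G h) (\<eta> X))"
    if "X \<in> Obj C" "h \<in> hom D (FO F X) Z" "g \<in> hom D Z W" for X Z W g h
    using is_functorD(6)[OF G that(2,3)] category.Comp_assoc[OF C unit[OF that(1)]
      is_functorD(4)[OF G that(2)] is_functorD(4)[OF G that(3)]] by simp
  \<comment> \<open>Naturality in the variable from \<open>C\<close>: the square \<open>nat\<close>
    moves \<open>k\<close> past \<open>\<eta>\<close>.\<close>
  have step: "Comp C (FA G (Comp D h (FA F k))) (\<eta> X') = Comp C (Comp C (FA G h) (\<eta> X)) k"
    if k: "k \<in> hom C X' X" and h: "h \<in> hom D (FO F X) Z" for X' X Z h k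
  proof -
    note obs = hom_Obj[OF C k]
    show ?thesis
      using comp[OF obs(1) FA[OF k] h] nat[OF k]
        category.Comp_assoc[OF C k unit[OF obs(2)] is_functorD(4)[OF G h]] by simp
  qed
  have F: "is_functor C D F"
    unfolding is_functor_def
  proof (intro conjI ballI)
    fix X assume X: "X \<in> Obj C"
    show "FA F (Ident C X) = Ident D (FO F X)"
    proof (rule eqI[OF X FA[OF category.Ident_in_hom[OF C X]] category.Ident_in_hom[OF D FO[OF X]]])
      show "Comp C (FA G (FA F (Ident C X))) (\<eta> X) = Comp C (FA G (Ident D (FO F X))) (\<eta> X)"
        using nat[OF category.Ident_in_hom[OF C X]] is_functorD(5)[OF G FO[OF X]]
          category.Comp_Ident_right[OF C unit[OF X]] category.Comp_Ident_left[OF C unit[OF X]]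
        by simp
    qed
  next
    fix X Y Z f g
    assume X: "X \<in> Obj C" and f: "f \<in> hom C X Y" and g: "g \<in> hom C Y Z"
    note gf = category.Comp_in_hom[OF C f g]
    show "FA F (Comp C g f) = Comp D (FA F g) (FA F f)"
    proof (rule eqI[OF X FA[OF gf] category.Comp_in_hom[OF D FA[OF f] FA[OF g]]])
      show "Comp C (FA G (FA F (Comp C g f))) (\<eta> X) = Comp C (FA G (Comp D (FA F g) (FA F f))) (\<eta> X)"
        using nat[OF gf] step[OF f FA[OF g]] nat[OF g]
          category.Comp_assoc[OF C f g unit[OF hom_Obj(2)[OF C g]]] by simp
    qed
  qed (use C D FO FA in auto)
  show ?thesis
    unfolding adjunction_def
  proof (intro conjI ballI F G)
    fix X Z assume X: "X \<in> Obj C" and Z: "Z \<in> Obj D"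
    show "bij_betw (\<lambda>h. Comp C (FA G h) (\<eta> X)) (hom D (FO F X) Z) (hom C X (FO G Z))"
    proof (rule bij_betw_imageI)
      show "inj_on (\<lambda>h. Comp C (FA G h) (\<eta> X)) (hom D (FO F X) Z)"
        using eqI[OF X] by (blast intro: inj_onI)
      show "(\<lambda>h. Comp C (FA G h) (\<eta> X)) ` hom D (FO F X) Z = hom C X (FO G Z)"
      proof
        show "(\<lambda>h. Comp C (FA G h) (\<eta> X)) ` hom D (FO F X) Z \<subseteq> hom C X (FO G Z)"
          using category.Comp_in_hom[OF C unit[OF X]] is_functorD(4)[OF G] by blast
        show "hom C X (FO G Z) \<subseteq> (\<lambda>h. Comp C (FA G h) (\<eta> X)) ` hom D (FO F X) Z"
          using univ[OF X Z] by blast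
      qed
    qed
  next
    fix X X' Z W k h g
    assume k: "k \<in> hom C X' X" and h: "h \<in> hom D (FO F X) Z" and g: "g \<in> hom D Z W"
    show "Comp C (FA G (Comp D g (Comp D h (FA F k)))) (\<eta> X') =
        Comp C (FA G g) (Comp C (Comp C (FA G h) (\<eta> X)) k)"
      using comp[OF hom_Obj(1)[OF C k] category.Comp_in_hom[OF D FA[OF k] h] g] step[OF k h] by simp
  qed
qed

section \<open>Opposite categories and arrows of the category of sets\<close>

lemma op_cat_simps [simp]:
  "Obj (op_cat C) = Obj C" "Arr (op_cat C) = Arr C" "Dom (op_cat C) = Cod C"
  "Cod (op_cat C) = Dom C" "Ident (op_cat C) = Ident C" "Comp (op_cat C) g f = Comp C f g"
  by (simp_all add: op_cat_def)

lemma hom_op_cat [simp]: "hom (op_cat C) X Y = hom C Y X"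
  by (auto simp: hom_def)

text \<open>\<open>r\<close> lands in \<open>op_cat A\<close>, so the equalisers in \<open>A\<close>
  are used in this dual form, as a property of arrows out of \<open>FO r X\<close>.\<close>

lemma is_coequaliser_op_cat: "is_coequaliser (op_cat C) f g c \<longleftrightarrow> is_equaliser C f g c"
  by (simp add: is_coequaliser_def is_equaliser_def)

lemma hom_set_cat:
  "f \<in> hom (set_cat U) X Y \<longleftrightarrow> X \<in> U \<and> Y \<in> U \<and> app f \<in> X \<rightarrow>\<^sub>E Y \<and> f = (X, app f, Y)"
  by (cases f) (auto simp: hom_def set_cat_def app_def)

lemma app_Comp_set_cat:
  assumes "f \<in> hom (set_cat U) X Y" "x \<in> X"
  shows "app (Comp (set_cat U) g f) x = app g (app f x)"
  using assms by (cases f; cases g) (auto simp: hom_def set_cat_def app_def compose_def)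

text \<open>Both functions lie in \<open>X \<rightarrow>\<^sub>E Y\<close> and so take the same
  default value outside \<open>X\<close>.\<close>

lemma set_cat_eq_iff:
  assumes "f \<in> hom (set_cat U) X Y" "g \<in> hom (set_cat U) X Y"
  shows "f = g \<longleftrightarrow> (\<forall>x \<in> X. app f x = app g x)"
proof
  assume "\<forall>x \<in> X. app f x = app g x"
  then have "app f = app g"
    using assms by (intro PiE_ext[where k = X and s = "\<lambda>_. Y"]) (auto simp: hom_set_cat)
  then show "f = g" using assms unfolding hom_set_cat by metis
qed simp

section \<open>The category of relations and the equality functor\<close>

abbreviation kl_under :: "'u set set \<Rightarrow> 'u set_monad \<Rightarrow> 'u set \<Rightarrow> 'u set" where
  "kl_under U T X \<equiv> FO (forget (set_cat U) T) X"

lemma Obj_Kl [simp]: "Obj (Kl U T) = U"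
  by (simp add: kleisli_def set_cat_def)

lemma Obj_int_Psi:
  "XR \<in> Obj (int_Psi U T) \<longleftrightarrow>
     fst XR \<in> U \<and> snd XR \<subseteq> kl_under U T (fst XR) \<times> kl_under U T (fst XR)"
  by (auto simp: int_Psi_def)

lemma hom_int_Psi:
  "F \<in> hom (int_Psi U T) XR YS \<longleftrightarrow> XR \<in> Obj (int_Psi U T) \<and> YS \<in> Obj (int_Psi U T) \<and>
     (\<exists>f \<in> hom (Kl U T) (fst XR) (fst YS). F = (XR, f, YS) \<and>
       (\<forall>(x, y) \<in> snd XR. (under_fun U T f x, under_fun U T f y) \<in> snd YS))"
  \<comment> \<open>\<open>hom_def\<close> is instantiated to explicit records so that the hom sets
    of \<open>Kl U T\<close> stay folded.\<close>
  by (cases XR; cases YS; cases F)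
    (auto simp: int_Psi_def hom_def[of "\<lparr>Obj = _, Arr = _, Dom = _, Cod = _, Ident = _, Comp = _\<rparr>"])

lemma Ident_int_Psi: "Ident (int_Psi U T) XR = (XR, Ident (Kl U T) (fst XR), XR)"
  by (cases XR) (simp add: int_Psi_def)

lemma Comp_int_Psi: "Comp (int_Psi U T) (YS', g, ZQ) (XR, f, YS) = (XR, Comp (Kl U T) g f, ZQ)"
  by (simp add: int_Psi_def)

lemma FO_Eq_func: "FO (Eq_func U T) X = (X, Id_on (kl_under U T X))"
  by (simp add: Eq_func_def)

lemma FA_Eq_func:
  "f \<in> hom (Kl U T) X Y \<Longrightarrow> FA (Eq_func U T) f = (FO (Eq_func U T) X, f, FO (Eq_func U T) Y)"
  by (auto simp: Eq_func_def hom_def)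

lemma FO_Eq_func_Obj: "X \<in> U \<Longrightarrow> FO (Eq_func U T) X \<in> Obj (int_Psi U T)"
  by (auto simp: FO_Eq_func Obj_int_Psi)

text \<open>A transpose only records the codomain, so composing with it is composing with
  \<open>p\<close> in \<open>set_cat\<close>. Equations involving \<open>proj1'\<close> and
  \<open>proj2'\<close> thereby become equations between functions.\<close>

lemma Comp_kl_transpose:
  assumes "f \<in> hom (Kl U T) X Y"
  shows "Comp (Kl U T) f (kl_transpose X p) = (Comp (set_cat U) (FA (forget (set_cat U) T) f) p, Y)"
  using assms by (cases f) (auto simp: kleisli_def hom_def kl_transpose_def forget_def)

context
  fixes U :: "'u set set" and T :: "'u set_monad"
  assumes monad: "is_monad (set_cat U) T"
begin

private lemmas K = category_kleisli[OF monad]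
private lemmas forget = is_functorD[OF is_functor_forget[OF monad]]

lemma under_fun_in:
  assumes "f \<in> hom (Kl U T) X Y" "x \<in> kl_under U T X"
  shows "under_fun U T f x \<in> kl_under U T Y"
  using forget(4)[OF assms(1)] assms(2) by (auto simp: under_fun_def hom_set_cat)

text \<open>The restriction on \<open>x\<close> matters: outside its domain an arrow of
  \<open>set_cat\<close> has the value \<open>undefined\<close>.\<close>

lemma under_fun_Ident: "X \<in> U \<Longrightarrow> x \<in> kl_under U T X \<Longrightarrow> under_fun U T (Ident (Kl U T) X) x = x"
  using forget(5)[of X] by (simp add: under_fun_def) (simp add: set_cat_def app_def)

lemma under_fun_Comp:
  assumes "f \<in> hom (Kl U T) X Y" "g \<in> hom (Kl U T) Y Z" "x \<in> kl_under U T X"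
  shows "under_fun U T (Comp (Kl U T) g f) x = under_fun U T g (under_fun U T f x)"
  using forget(6)[OF assms(1,2)] app_Comp_set_cat[OF forget(4)[OF assms(1)] assms(3)]
  by (simp add: under_fun_def)

lemma category_int_Psi: "category (int_Psi U T)"
proof unfold_locales
  fix F assume "F \<in> Arr (int_Psi U T)"
  then show "Dom (int_Psi U T) F \<in> Obj (int_Psi U T)" "Cod (int_Psi U T) F \<in> Obj (int_Psi U T)"
    by (auto simp: int_Psi_def)
next
  fix XR assume "XR \<in> Obj (int_Psi U T)"
  then show "Ident (int_Psi U T) XR \<in> hom (int_Psi U T) XR XR"
    using category.Ident_in_hom[OF K, of "fst XR"]
    by (auto simp: hom_int_Psi Ident_int_Psi Obj_int_Psi under_fun_Ident subset_iff)
next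
  fix F G XR YS ZQ
  assume "F \<in> hom (int_Psi U T) XR YS" "G \<in> hom (int_Psi U T) YS ZQ"
  then obtain f g where f: "F = (XR, f, YS)" "f \<in> hom (Kl U T) (fst XR) (fst YS)"
      "\<forall>(x, y) \<in> snd XR. (under_fun U T f x, under_fun U T f y) \<in> snd YS"
    and g: "G = (YS, g, ZQ)" "g \<in> hom (Kl U T) (fst YS) (fst ZQ)"
      "\<forall>(x, y) \<in> snd YS. (under_fun U T g x, under_fun U T g y) \<in> snd ZQ"
    and obs: "XR \<in> Obj (int_Psi U T)" "ZQ \<in> Obj (int_Psi U T)"
    by (auto simp: hom_int_Psi)
  have "(under_fun U T (Comp (Kl U T) g f) x, under_fun U T (Comp (Kl U T) g f) y) \<in> snd ZQ"
    if "(x, y) \<in> snd XR" for x y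
  proof -
    \<comment> \<open>\<open>under_fun_Comp\<close> speaks only of elements of the carrier; related
      elements are such by the definition of objects.\<close>
    have "x \<in> kl_under U T (fst XR)" "y \<in> kl_under U T (fst XR)"
      using obs(1) that by (auto simp: Obj_int_Psi)
    then show ?thesis using that f(3) g(3) by (auto simp: under_fun_Comp[OF f(2) g(2)])
  qed
  then show "Comp (int_Psi U T) G F \<in> hom (int_Psi U T) XR ZQ"
    using category.Comp_in_hom[OF K f(2) g(2)] obs
    by (auto simp: hom_int_Psi f(1) g(1) Comp_int_Psi)
qed (auto simp: hom_int_Psi Comp_int_Psi Ident_int_Psi category.Comp_Ident_left[OF K]
    category.Comp_Ident_right[OF K] category.Comp_assoc[OF K])

lemma is_functor_Eq_func: "is_functor (Kl U T) (int_Psi U T) (Eq_func U T)"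
  unfolding is_functor_def
proof (intro conjI ballI)
  fix X Y f assume "X \<in> Obj (Kl U T)" "Y \<in> Obj (Kl U T)" and f: "f \<in> hom (Kl U T) X Y"
  then show "FA (Eq_func U T) f \<in> hom (int_Psi U T) (FO (Eq_func U T) X) (FO (Eq_func U T) Y)"
    using under_fun_in[OF f]
    by (auto simp: FA_Eq_func[OF f] hom_int_Psi FO_Eq_func_Obj) (auto simp: FO_Eq_func)
next
  fix X assume "X \<in> Obj (Kl U T)"
  then show "FA (Eq_func U T) (Ident (Kl U T) X) = Ident (int_Psi U T) (FO (Eq_func U T) X)"
    using FA_Eq_func[OF category.Ident_in_hom[OF K]] by (simp add: Ident_int_Psi FO_Eq_func)
next
  fix X Y Z f g assume f: "f \<in> hom (Kl U T) X Y" and g: "g \<in> hom (Kl U T) Y Z"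
  show "FA (Eq_func U T) (Comp (Kl U T) g f) =
      Comp (int_Psi U T) (FA (Eq_func U T) g) (FA (Eq_func U T) f)"
    by (simp add: FA_Eq_func[OF f] FA_Eq_func[OF g] FA_Eq_func[OF category.Comp_in_hom[OF K f g]]
        Comp_int_Psi)
qed (auto simp: K category_int_Psi FO_Eq_func_Obj)

section \<open>Relations as small sets, and morphisms into equality relations\<close>

context
  fixes pr :: "'u \<times> 'u \<Rightarrow> 'u"
  assumes univ: "set_universe U pr"
begin

lemma rel_proj_in_hom:
  assumes "A \<in> U" "R \<subseteq> A \<times> A"
  shows "rel_proj1 pr A R \<in> hom (set_cat U) (rel_set pr R) A"
    and "rel_proj2 pr A R \<in> hom (set_cat U) (rel_set pr R) A"
proof -
  interpret set_universe U pr by (rule univ)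
  \<comment> \<open>\<open>rel_set pr R\<close> lies inside the \<open>pr\<close>-image of
    \<open>A \<times> A\<close>, which is small.\<close>
  have "rel_set pr R \<in> U"
    unfolding rel_set_def by (rule subset_closed[OF prod_closed[OF assms(1,1)]]) (use assms in auto)
  then show "rel_proj1 pr A R \<in> hom (set_cat U) (rel_set pr R) A"
    and "rel_proj2 pr A R \<in> hom (set_cat U) (rel_set pr R) A"
    using assms
    by (auto simp: hom_set_cat app_def rel_proj1_def rel_proj2_def rel_set_def inv_f_f[OF inj_pr])
qed

lemma app_rel_proj:
  assumes "(x, y) \<in> R"
  shows "app (rel_proj1 pr A R) (pr (x, y)) = x" "app (rel_proj2 pr A R) (pr (x, y)) = y"
  using assms inv_f_f[OF set_universe.inj_pr[OF univ]]
  by (auto simp: app_def rel_proj1_def rel_proj2_def rel_set_def)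

text \<open>\<open>iota\<close> fixes objects, so the transposes start at
  \<open>rel_set pr (snd XR)\<close> itself.\<close>

lemma proj_in_hom:
  assumes "XR \<in> Obj (int_Psi U T)"
  shows "proj1' pr U T XR \<in> hom (Kl U T) (rel_set pr (snd XR)) (fst XR)"
    and "proj2' pr U T XR \<in> hom (Kl U T) (rel_set pr (snd XR)) (fst XR)"
proof -
  have X: "fst XR \<in> Obj (set_cat U)" "kl_under U T (fst XR) \<in> U"
    "snd XR \<subseteq> kl_under U T (fst XR) \<times> kl_under U T (fst XR)"
    using assms forget(3)[of "fst XR"] by (auto simp: Obj_int_Psi) (auto simp: set_cat_def)
  show "proj1' pr U T XR \<in> hom (Kl U T) (rel_set pr (snd XR)) (fst XR)"
    and "proj2' pr U T XR \<in> hom (Kl U T) (rel_set pr (snd XR)) (fst XR)"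
    using kl_transpose(1)[OF monad X(1) rel_proj_in_hom(1)[OF X(2,3)]]
      kl_transpose(1)[OF monad X(1) rel_proj_in_hom(2)[OF X(2,3)]]
    by (simp_all add: proj1'_def proj2'_def iota_def case_prod_unfold)
qed

text \<open>Sending related elements into the diagonal means identifying them. The points of
  \<open>rel_set pr R\<close> are the related pairs, so this is agreement of two functions on that
  set, that is, of the composites of \<open>k\<close> with the two projections.\<close>

lemma hom_Eq_func_iff:
  assumes XR: "XR \<in> Obj (int_Psi U T)"
  shows "F \<in> hom (int_Psi U T) XR (FO (Eq_func U T) Y) \<longleftrightarrow>
    (\<exists>k \<in> hom (Kl U T) (fst XR) Y. F = (XR, k, FO (Eq_func U T) Y) \<and>
      Comp (Kl U T) k (proj1' pr U T XR) = Comp (Kl U T) k (proj2' pr U T XR))"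
proof -
  obtain X R where XR_eq: "XR = (X, R)" by (cases XR)
  have X: "kl_under U T X \<in> U" and R: "R \<subseteq> kl_under U T X \<times> kl_under U T X"
    using XR forget(3)[of X] by (auto simp: XR_eq Obj_int_Psi) (auto simp: set_cat_def)
  have "(\<forall>(x, y) \<in> R. (under_fun U T k x, under_fun U T k y) \<in> Id_on (kl_under U T Y)) \<longleftrightarrow>
      Comp (Kl U T) k (proj1' pr U T XR) = Comp (Kl U T) k (proj2' pr U T XR)"
    if k: "k \<in> hom (Kl U T) X Y" for k
  proof -
    note p = rel_proj_in_hom[OF X R] and k' = forget(4)[OF k]
    note kp = category.Comp_in_hom[OF category_set_cat _ k']
    have "Comp (Kl U T) k (proj1' pr U T XR) = Comp (Kl U T) k (proj2' pr U T XR) \<longleftrightarrow>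
        Comp (set_cat U) (FA (forget (set_cat U) T) k) (rel_proj1 pr (kl_under U T X) R) =
        Comp (set_cat U) (FA (forget (set_cat U) T) k) (rel_proj2 pr (kl_under U T X) R)"
      by (simp add: proj1'_def proj2'_def XR_eq Comp_kl_transpose[OF k])
    also have "\<dots> \<longleftrightarrow> (\<forall>z \<in> rel_set pr R. under_fun U T k (app (rel_proj1 pr (kl_under U T X) R) z) =
        under_fun U T k (app (rel_proj2 pr (kl_under U T X) R) z))"
      by (simp add: set_cat_eq_iff[OF kp[OF p(1)] kp[OF p(2)]] app_Comp_set_cat[OF p(1)]
          app_Comp_set_cat[OF p(2)] under_fun_def)
    also have "\<dots> \<longleftrightarrow> (\<forall>(x, y) \<in> R. under_fun U T k x = under_fun U T k y)"
      by (auto simp: rel_set_def app_rel_proj)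
    \<comment> \<open>\<open>Id_on\<close> also demands membership in the carrier of
      \<open>Y\<close>, which \<open>under_fun_in\<close> supplies.\<close>
    also have "\<dots> \<longleftrightarrow> (\<forall>(x, y) \<in> R. (under_fun U T k x, under_fun U T k y) \<in> Id_on (kl_under U T Y))"
      using R under_fun_in[OF k] by (auto simp: Id_on_iff)
    finally show ?thesis by simp
  qed
  \<comment> \<open>\<open>Y\<close> is not assumed to be small; on the right-hand side this follows
    from its being the codomain of \<open>k\<close>.\<close>
  moreover have "FO (Eq_func U T) Y \<in> Obj (int_Psi U T)" if "k \<in> hom (Kl U T) X Y" for k
    using hom_Obj(2)[OF K that] by (simp add: FO_Eq_func_Obj)
  ultimately show ?thesis
    using XR by (auto simp: hom_int_Psi XR_eq FO_Eq_func)
qed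

end

end

section \<open>The adjunction between \<open>Sbar\<close> and the equality functor after
  \<open>j\<close>\<close>

theorem theorem5:
  fixes U :: "'u set set" and pr :: "'u \<times> 'u \<Rightarrow> 'u"
    and T :: "'u set_monad"
    and A :: "('p, 'b) cat"
    and j :: "('p, 'b, 'u set, 'u kl_arr) func"
    and r :: "('u set, 'u kl_arr, 'p, 'b) func"
    and e :: "'u rel_obj \<Rightarrow> 'b"
  assumes "set_universe U pr"
    and "is_monad (set_cat U) T"
    and "has_binary_products (Kl U T)"
    and "category A"
    and "reflective_subcategory (op_cat A) (Kl U T) j r"
    and "has_coequalisers (op_cat A)"
    and "\<And>XR. XR \<in> Obj (int_Psi U T) \<Longrightarrow>
           is_equaliser A (FA r (proj1' pr U T XR)) (FA r (proj2' pr U T XR)) (e XR)"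
  shows "(\<forall>F \<in> Arr (int_Psi U T). \<exists>!h. is_Sbar_map A r e F h) \<and>
    is_functor (int_Psi U T) (op_cat A) (Sbar A r e) \<and>
    left_adjoint (int_Psi U T) (op_cat A) (Sbar A r e) (comp_func (Eq_func U T) j)"
proof -
  let ?K = "Kl U T" and ?P = "int_Psi U T" and ?B = "op_cat A" and ?S = "Sbar A r e"
  let ?G = "comp_func (Eq_func U T) j"
  note univ = assms(1) and monad = assms(2)
  obtain \<phi> where adj: "adjunction ?K ?B r j \<phi>"
    using assms(5) by (auto simp: reflective_subcategory_def left_adjoint_def)
  note r = is_functorD[OF adjunctionD(1)[OF adj]] and j = is_functorD[OF adjunctionD(2)[OF adj]]
  note K = r(1) and B = r(2) and Eq = is_functor_Eq_func[OF monad]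
  note P = category_int_Psi[OF monad]
  note G = is_functor_comp_func[OF adjunctionD(2)[OF adj] Eq]
  have FO_G: "FO ?G Z = FO (Eq_func U T) (FO j Z)" for Z
    by (simp add: comp_func_def)
  have FA_G: "FA ?G h = (FO ?G Z, FA j h, FO ?G W)" if "h \<in> hom ?B Z W" for h Z W
    using FA_Eq_func[OF j(4)[OF that]] by (simp add: comp_func_def)
  have S_Obj: "FO ?S XR = Dom A (e XR)" for XR
    by (simp add: Sbar_def)
  have fst_Obj: "fst XR \<in> Obj ?K" if "XR \<in> Obj ?P" for XR
    using that by (simp add: Obj_int_Psi)
  have coeq: "is_coequaliser ?B (FA r (proj1' pr U T XR)) (FA r (proj2' pr U T XR)) (e XR)"
    if "XR \<in> Obj ?P" for XR
    using assms(7)[OF that] by (simp add: is_coequaliser_op_cat)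
  \<comment> \<open>The coequaliser property is phrased through this codomain, here identified with
    the reflection of \<open>fst XR\<close>.\<close>
  have cod: "Cod ?B (FA r (proj1' pr U T XR)) = FO r (fst XR)" if "XR \<in> Obj ?P" for XR
    using r(4)[OF proj_in_hom(1)[OF monad univ that]] by (simp add: hom_def)
  have e: "e XR \<in> hom ?B (FO r (fst XR)) (FO ?S XR)" if "XR \<in> Obj ?P" for XR
    using coeq[OF that] cod[OF that] by (simp add: is_coequaliser_def S_Obj hom_def)
  have S_in: "FO ?S XR \<in> Obj ?B" if "XR \<in> Obj ?P" for XR
    using hom_Obj(2)[OF B e[OF that]] .
  have bij: "bij_betw (\<phi> (fst XR) Z) (hom ?B (FO r (fst XR)) Z) (hom ?K (fst XR) (FO j Z))"
    if "XR \<in> Obj ?P" "Z \<in> Obj ?B" for XR Z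
    using adjunctionD(3)[OF adj fst_Obj[OF that(1)] that(2)] .
  have \<phi>_eq_iff: "\<phi> X Z h = \<phi> X Z h' \<longleftrightarrow> h = h'"
    if "h \<in> hom ?B (FO r X) Z" "h' \<in> hom ?B (FO r X) Z" "X \<in> Obj ?K" for X Z h h'
    using adjunctionD(3)[OF adj that(3) hom_Obj(2)[OF B that(1)]] that(1,2)
    by (meson bij_betw_imp_inj_on inj_on_eq_iff)

  have transpose: "(XR, \<phi> (fst XR) Z k, FO ?G Z) \<in> hom ?P XR (FO ?G Z) \<longleftrightarrow>
      Comp ?B k (FA r (proj1' pr U T XR)) = Comp ?B k (FA r (proj2' pr U T XR))"
    if XR: "XR \<in> Obj ?P" and k: "k \<in> hom ?B (FO r (fst XR)) Z" for XR Z k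
  proof -
    note p = proj_in_hom[OF monad univ XR] and Z = hom_Obj(2)[OF B k]
    have k': "\<phi> (fst XR) Z k \<in> hom ?K (fst XR) (FO j Z)"
      using bij[OF XR Z] k by (auto simp: bij_betw_def)
    have kp: "Comp ?B k (FA r q) \<in> hom ?B (FO r (rel_set pr (snd XR))) Z"
      if "q \<in> hom ?K (rel_set pr (snd XR)) (fst XR)" for q
      using category.Comp_in_hom[OF B r(4)[OF that] k] .
    have "(XR, \<phi> (fst XR) Z k, FO ?G Z) \<in> hom ?P XR (FO ?G Z) \<longleftrightarrow>
        Comp ?K (\<phi> (fst XR) Z k) (proj1' pr U T XR) = Comp ?K (\<phi> (fst XR) Z k) (proj2' pr U T XR)"
      using hom_Eq_func_iff[OF monad univ XR] k' by (auto simp: FO_G)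
    \<comment> \<open>Naturality of \<open>\<phi>\<close> in its first variable brings the
      projections inside the transpose, where injectivity then removes
      \<open>\<phi>\<close>.\<close>
    also have "\<dots> \<longleftrightarrow> \<phi> (rel_set pr (snd XR)) Z (Comp ?B k (FA r (proj1' pr U T XR))) =
        \<phi> (rel_set pr (snd XR)) Z (Comp ?B k (FA r (proj2' pr U T XR)))"
      by (simp only: adjunctionD(4)[OF adj p(1) Z k] adjunctionD(4)[OF adj p(2) Z k])
    also have "\<dots> \<longleftrightarrow>
        Comp ?B k (FA r (proj1' pr U T XR)) = Comp ?B k (FA r (proj2' pr U T XR))"
      by (rule \<phi>_eq_iff[OF kp[OF p(1)] kp[OF p(2)] hom_Obj(1)[OF K p(1)]])
    finally show ?thesis .
  qed

  \<comment> \<open>The unit is the transpose of \<open>e XR\<close>; it respects relations by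
    \<open>transpose\<close>, because \<open>e XR\<close> coequalises the reflected
    projections.\<close>
  define \<eta> where "\<eta> XR = (XR, \<phi> (fst XR) (FO ?S XR) (e XR), FO ?G (FO ?S XR))" for XR
  have \<eta>: "\<eta> XR \<in> hom ?P XR (FO ?G (FO ?S XR))" if "XR \<in> Obj ?P" for XR
    using transpose[OF that e[OF that]] coeq[OF that] by (simp add: \<eta>_def is_coequaliser_def)
  \<comment> \<open>By naturality in the second variable, composing with the unit is transposing the
    composite with \<open>e XR\<close>.\<close>
  have G_\<eta>: "Comp ?P (FA ?G h) (\<eta> XR) = (XR, \<phi> (fst XR) Z (Comp ?B h (e XR)), FO ?G Z)"
    if "XR \<in> Obj ?P" "h \<in> hom ?B (FO ?S XR) Z" for XR h Z
    using adjunctionD(5)[OF adj fst_Obj[OF that(1)] e[OF that(1)] that(2)]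
    by (simp only: \<eta>_def FA_G[OF that(2)] Comp_int_Psi)
  have universal: "\<exists>!h. h \<in> hom ?B (FO ?S XR) Z \<and> Comp ?P (FA ?G h) (\<eta> XR) = F"
    if XR: "XR \<in> Obj ?P" and Z: "Z \<in> Obj ?B" and F: "F \<in> hom ?P XR (FO ?G Z)" for XR Z F
  proof -
    obtain k' where "k' \<in> hom ?K (fst XR) (FO j Z)" and F_eq: "F = (XR, k', FO ?G Z)"
      using F hom_Eq_func_iff[OF monad univ XR] by (auto simp: FO_G)
    \<comment> \<open>Surjectivity of \<open>\<phi>\<close> writes \<open>F\<close> as a transpose.
      As \<open>F\<close> preserves relations, \<open>transpose\<close> makes \<open>k\<close>
      coequalise the projections, so it factors uniquely through \<open>e XR\<close>.\<close>
    then obtain k where k: "k \<in> hom ?B (FO r (fst XR)) Z" "k' = \<phi> (fst XR) Z k"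
      using bij[OF XR Z] by (auto simp: bij_betw_def)
    have "Comp ?P (FA ?G h) (\<eta> XR) = F \<longleftrightarrow> Comp ?B h (e XR) = k"
      if "h \<in> hom ?B (FO ?S XR) Z" for h
      using G_\<eta>[OF XR that] k(2)
        \<phi>_eq_iff[OF category.Comp_in_hom[OF B e[OF XR] that] k(1) fst_Obj[OF XR]]
      by (simp add: F_eq)
    moreover have "\<exists>!h. h \<in> hom ?B (FO ?S XR) Z \<and> Comp ?B h (e XR) = k"
      using coeq[OF XR] Z k(1) transpose[OF XR k(1)] F e[OF XR]
      unfolding is_coequaliser_def cod[OF XR] F_eq k(2) by (auto simp: hom_def)
    ultimately show ?thesis by (metis (no_types, lifting))
  qed

  \<comment> \<open>Read in \<open>op_cat A\<close>, the equation defining \<open>Sbar\<close> has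
    as its transpose the naturality square of \<open>\<eta>\<close> at \<open>F\<close>.\<close>
  have Sbar_map_iff: "is_Sbar_map A r e F h \<longleftrightarrow>
      h \<in> hom ?B (FO ?S XR) (FO ?S YS) \<and> Comp ?P (FA ?G h) (\<eta> XR) = Comp ?P (\<eta> YS) F"
    if F: "F \<in> hom ?P XR YS" for F XR YS h
  proof -
    note obs = hom_Obj[OF P F]
    obtain f where f: "f \<in> hom ?K (fst XR) (fst YS)" "F = (XR, f, YS)"
      using F by (auto simp: hom_int_Psi)
    have "Comp ?P (\<eta> YS) F =
        (XR, \<phi> (fst XR) (FO ?S YS) (Comp ?B (e YS) (FA r f)), FO ?G (FO ?S YS))"
      by (simp only: f(2) \<eta>_def Comp_int_Psi
          adjunctionD(4)[OF adj f(1) S_in[OF obs(2)] e[OF obs(2)]])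
    moreover have ef: "Comp ?B (e YS) (FA r f) \<in> hom ?B (FO r (fst XR)) (FO ?S YS)"
      using category.Comp_in_hom[OF B r(4)[OF f(1)] e[OF obs(2)]] .
    ultimately have "Comp ?P (FA ?G h) (\<eta> XR) = Comp ?P (\<eta> YS) F \<longleftrightarrow>
        Comp ?B h (e XR) = Comp ?B (e YS) (FA r f)"
      if "h \<in> hom ?B (FO ?S XR) (FO ?S YS)"
      using G_\<eta>[OF obs(1) that]
        \<phi>_eq_iff[OF category.Comp_in_hom[OF B e[OF obs(1)] that] ef fst_Obj[OF obs(1)]]
      by simp
    then show ?thesis
      by (auto simp: is_Sbar_map_def f(2) S_Obj)
  qed
  \<comment> \<open>This is \<open>universal\<close> for the composite of \<open>F\<close> with the
    unit at \<open>YS\<close>; it also makes the \<open>THE\<close> in \<open>Sbar\<close> well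
    defined.\<close>
  have ex1: "\<exists>!h. is_Sbar_map A r e F h" if F: "F \<in> hom ?P XR YS" for F XR YS
    unfolding Sbar_map_iff[OF F]
    using universal[OF hom_Obj(1)[OF P F] S_in[OF hom_Obj(2)[OF P F]]
        category.Comp_in_hom[OF P F \<eta>[OF hom_Obj(2)[OF P F]]]] .
  have FA_S: "is_Sbar_map A r e F (FA ?S F)" if "F \<in> hom ?P XR YS" for F XR YS
    using theI'[OF ex1[OF that]] by (simp add: Sbar_def)
  have adj': "adjunction ?P ?B ?S ?G (\<lambda>XR Z h. Comp ?P (FA ?G h) (\<eta> XR))"
  proof (rule universal_arrows_adjunction[OF P G S_in \<eta> universal])
    \<comment> \<open>The two premises left, typing and naturality, are the two conjuncts of
      \<open>Sbar_map_iff\<close>.\<close>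
    fix XR YS F assume F: "F \<in> hom ?P XR YS"
    show "FA ?S F \<in> hom ?B (FO ?S XR) (FO ?S YS)"
      and "Comp ?P (FA ?G (FA ?S F)) (\<eta> XR) = Comp ?P (\<eta> YS) F"
      using FA_S[OF F] by (simp_all only: Sbar_map_iff[OF F])
  qed
  from adj' have "is_functor ?P ?B ?S" and "left_adjoint ?P ?B ?S ?G"
    by (rule adjunctionD(1)) (use adj' in \<open>unfold left_adjoint_def, blast\<close>)
  moreover have "\<forall>F \<in> Arr ?P. \<exists>!h. is_Sbar_map A r e F h"
    using ex1 by (auto simp: hom_def)
  ultimately show ?thesis by simp
qed

end
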